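(* Let $W$ and $\tilde W$ be weight matrices of size $N$ supported on the same interval, with sequences of monic orthogonal polynomials $\{P_n\}_{n\ge 0}$ and $\{\tilde P_n\}_{n\ge 0}$ respectively. Suppose $\tilde W$ is a Darboux transformation of $W$, with $D=\mathcal V\mathcal N\in\mathcal D(W)$, where $\mathcal V,\mathcal N\in \operatorname{Mat}_N(\Omega[x])$ are degree-preserving and $P_n\cdot\mathcal V=A_n\tilde P_n$ for all $n\in\mathbb N_0$, for some $A_n\in\operatorname{Mat}_N(\mathbb C)$. If $D=\mathcal V\mathcal N$ belongs to the center of $\mathcal D(W)$, then $$\mathcal N\,\mathcal Z(W)\,\mathcal V\subseteq \mathcal Z(\tilde W)\qquad\text{and}\qquad \mathcal V\,\mathcal Z(\tilde W)\,\mathcal N\subseteq\mathcal Z(W).$$ In particular, $\tilde D=\mathcal N\mathcal V$ belongs to $\mathcal Z(\tilde W)$.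
   Context: A weight matrix $W$ of size $N$ on an interval $(x_0,x_1)$ is a smooth function $W:(x_0,x_1)\to\operatorname{Mat}_N(\mathbb C)$, positive definite almost everywhere, with finite moments of all orders. Standing assumption: for each integer $n\ge0$ the derivative $W^{(n)}(x)$ decreases exponentially at infinity and there is a scalar polynomial $p_n(x)$ such that $W^{(n)}(x)p_n(x)$ has finite moments. The sesquilinear form is $\langle P,Q\rangle_W=\int_{x_0}^{x_1}P(x)W(x)Q(x)^*dx$ on $\operatorname{Mat}_N(\mathbb C[x])$. There is a unique sequence of monic matrix polynomials $P_n$ ($\deg P_n=n$, leading coefficient $I$) with $\langle P_n,P_m\rangle_W=0$ for $n\ne m$. $\operatorname{Mat}_N(\Omega[x])$ is the algebra of matrix differential operators $D=\sum_{j=0}^m\partial^jF_j(x)$, $F_j\in\operatorname{Mat}_N(\mathbb C[x])$, acting on the right: $P\cdot D=\sum_j \partial^j(P)(x)F_j(x)$; products satisfy $P\cdot(D_1D_2)=(P\cdot D_1)\cdot D_2$. $\mathcal D(W)=\{D\in\operatorname{Mat}_N(\Omega[x]): \text{for all } n\ge0,\ P_n\cdot D=\Lambda_n(D)P_n\text{ for some }\Lambda_n(D)\in\operatorname{Mat}_N(\mathbb C)\}$, and $\mathcal Z(W)$ denotes the center of the algebra $\mathcal D(W)$. An operator $\mathcal V\in\operatorname{Mat}_N(\Omega[x])$ is degree-preserving if $\deg(P\cdot\mathcal V)=\deg P$ for all $P\in\operatorname{Mat}_N(\mathbb C[x])$. $\tilde W$ is a Darboux transformation of $W$ if there is $D\in\mathcal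 D(W)$ that factors as $D=\mathcal V\mathcal N$ with $\mathcal V,\mathcal N$ degree-preserving and $P_n\cdot\mathcal V=A_n\tilde P_n$ for all $n\in\mathbb N_0$, for some $A_n\in\operatorname{Mat}_N(\mathbb C)$. *)

theory Defs
  imports
    "HOL-Analysis.Analysis"
    "HOL-Computational_Algebra.Polynomial"
    "HOL-Library.Landau_Symbols"
begin

section \<open>Matrix polynomials\<close>

type_synonym 'n cmat = "complex ^ 'n ^ 'n"
type_synonym 'n mpoly = "complex poly ^ 'n ^ 'n"

definition adjoint_mat :: "'n::finite cmat \<Rightarrow> 'n cmat"
  where "adjoint_mat A = (\<chi> i j. cnj (A $ j $ i))"

definition mconst :: "'n::finite cmat \<Rightarrow> 'n mpoly"
  where "mconst A = (\<chi> i j. [:A $ i $ j:])"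

definition meval :: "'n::finite mpoly \<Rightarrow> real \<Rightarrow> 'n cmat"
  where "meval P x = (\<chi> i j. poly (P $ i $ j) (complex_of_real x))"

definition mcoeff :: "'n::finite mpoly \<Rightarrow> nat \<Rightarrow> 'n cmat"
  where "mcoeff P k = (\<chi> i j. coeff (P $ i $ j) k)"

text \<open>As for \<^const>\<open>degree\<close>, the zero matrix polynomial gets degree \<open>0\<close>.\<close>

definition mdegree :: "'n::finite mpoly \<Rightarrow> nat"
  where "mdegree P = Max (range (\<lambda>(i, j). degree (P $ i $ j)))"

definition mderiv :: "nat \<Rightarrow> 'n::finite mpoly \<Rightarrow> 'n mpoly"
  where "mderiv k P = (\<chi> i j. (pderiv ^^ k) (P $ i $ j))"


section \<open>Weight matrices\<close>

definition pos_def_mat :: "'n::finite cmat \<Rightarrow> bool"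
  where "pos_def_mat A \<longleftrightarrow> adjoint_mat A = A \<and>
    (\<forall>v. v \<noteq> 0 \<longrightarrow> 0 < Re (\<Sum>i\<in>UNIV. \<Sum>j\<in>UNIV. cnj (v $ i) * A $ i $ j * v $ j))"

definition iter_deriv :: "nat \<Rightarrow> (real \<Rightarrow> 'n::finite cmat) \<Rightarrow> real \<Rightarrow> 'n cmat"
  where "iter_deriv k W = ((\<lambda>f x. vector_derivative f (at x)) ^^ k) W"

definition finite_moments :: "ereal \<Rightarrow> ereal \<Rightarrow> (real \<Rightarrow> 'n::finite cmat) \<Rightarrow> bool"
  where "finite_moments x0 x1 W \<longleftrightarrow>
    (\<forall>k::nat. set_integrable lborel (einterval x0 x1) (\<lambda>x. x ^ k *\<^sub>R W x))"

text \<open>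
  Only the values of \<open>W\<close> on the open interval from \<open>x0\<close> to \<open>x1\<close>, whose end points may be
  infinite, are relevant.
\<close>

definition weight_matrix :: "ereal \<Rightarrow> ereal \<Rightarrow> (real \<Rightarrow> 'n::finite cmat) \<Rightarrow> bool"
  where "weight_matrix x0 x1 W \<longleftrightarrow> x0 < x1 \<and>
    (\<forall>k. \<forall>x\<in>einterval x0 x1. iter_deriv k W differentiable (at x)) \<and>
    (AE x in lborel. x \<in> einterval x0 x1 \<longrightarrow> pos_def_mat (W x)) \<and>
    finite_moments x0 x1 W"

text \<open>
  Exponential decay at infinity is a condition at each infinite end point of the interval. The
  polynomial \<open>p\<close> has to be nonzero, since otherwise the second condition would be void.
\<close>

definition exp_decreasing :: "ereal \<Rightarrow> ereal \<Rightarrow> (real \<Rightarrow> 'n::finite cmat) \<Rightarrow> bool"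
  where "exp_decreasing x0 x1 f \<longleftrightarrow>
    (x1 = \<infinity> \<longrightarrow> (\<exists>c>0. (\<lambda>x. norm (f x)) \<in> O[at_top](\<lambda>x. exp (- c * x)))) \<and>
    (x0 = -\<infinity> \<longrightarrow> (\<exists>c>0. (\<lambda>x. norm (f x)) \<in> O[at_bot](\<lambda>x. exp (c * x))))"

definition regular_weight :: "ereal \<Rightarrow> ereal \<Rightarrow> (real \<Rightarrow> 'n::finite cmat) \<Rightarrow> bool"
  where "regular_weight x0 x1 W \<longleftrightarrow>
    (\<forall>n. exp_decreasing x0 x1 (iter_deriv n W) \<and>
      (\<exists>p::complex poly. p \<noteq> 0 \<and>
        finite_moments x0 x1 (\<lambda>x. iter_deriv n W x ** mat (poly p (complex_of_real x)))))"

definition form :: "ereal \<Rightarrow> ereal \<Rightarrow> (real \<Rightarrow> 'n::finite cmat) \<Rightarrow> 'n mpoly \<Rightarrow> 'n mpoly \<Rightarrow> 'n cmat"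
  where "form x0 x1 W P Q =
    (LINT x:einterval x0 x1|lborel. meval P x ** W x ** adjoint_mat (meval Q x))"

definition monic_orthogonal ::
  "ereal \<Rightarrow> ereal \<Rightarrow> (real \<Rightarrow> 'n::finite cmat) \<Rightarrow> (nat \<Rightarrow> 'n mpoly) \<Rightarrow> bool"
  where "monic_orthogonal x0 x1 W P \<longleftrightarrow>
    (\<forall>n. mdegree (P n) = n \<and> mcoeff (P n) n = mat 1) \<and>
    (\<forall>n m. n \<noteq> m \<longrightarrow> form x0 x1 W (P n) (P m) = 0)"

definition monic_ops ::
  "ereal \<Rightarrow> ereal \<Rightarrow> (real \<Rightarrow> 'n::finite cmat) \<Rightarrow> nat \<Rightarrow> 'n mpoly"
  where "monic_ops x0 x1 W = (THE P. monic_orthogonal x0 x1 W P)"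


section \<open>Matrix differential operators\<close>

text \<open>
  A differential operator is identified with the map \<open>P \<mapsto> P \<cdot> D\<close> that it induces on matrix
  polynomials. No information is lost: by \<open>diff_op_coeffs_unique\<close> below, the map
  determines the coefficients. Since operators act on the right, the product \<open>D E\<close> applies \<open>D\<close> first.
\<close>

type_synonym 'n oper = "'n mpoly \<Rightarrow> 'n mpoly"

definition diff_op :: "nat \<Rightarrow> (nat \<Rightarrow> 'n::finite mpoly) \<Rightarrow> 'n oper"
  where "diff_op m F = (\<lambda>P. \<Sum>j\<le>m. mderiv j P ** F j)"

definition diff_ops :: "'n::finite oper set"
  where "diff_ops = {diff_op m F | m F. True}"

definition oper_mult :: "'n oper \<Rightarrow> 'n oper \<Rightarrow> 'n oper"  (infixl \<open>\<odot>\<close> 70)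
  where "D \<odot> E = (\<lambda>P. E (D P))"

lemma mderiv_mat_monom:
  "mderiv k (mat (monom 1 k)) = mat [:fact k:]"
  "k < j \<Longrightarrow> mderiv j (mat (monom 1 k)) = 0"
proof -
  have same: "(pderiv ^^ k) (monom c k) = [:fact k * c:]" for c :: complex and k
    by (induction k arbitrary: c)
      (simp_all del: funpow.simps(2) add: funpow_Suc_right pderiv_monom monom_0 algebra_simps)
  have zero: "(pderiv ^^ j) (monom c k) = 0" if "k < j" for c :: complex and j k
    using that
  proof (induction j arbitrary: c k)
    case (Suc j)
    then show ?case
      by (cases k)
        (simp_all del: funpow.simps(2) add: funpow_Suc_right pderiv_monom monom_0 pderiv_pCons)
  qed simp
  show "mderiv k (mat (monom 1 k)) = mat [:fact k:]"
    by (simp add: mderiv_def mat_def vec_eq_iff same)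
  show "k < j \<Longrightarrow> mderiv j (mat (monom 1 k)) = 0"
    by (simp add: mderiv_def mat_def vec_eq_iff zero)
qed

lemma diff_op_coeffs_unique:
  fixes F G :: "nat \<Rightarrow> 'n::finite mpoly"
  assumes eq: "diff_op m F = diff_op m G" and "k \<le> m"
  shows "F k = G k"
  using \<open>k \<le> m\<close>
proof (induction k rule: less_induct)
  case (less k)
  let ?X = "mat (monom 1 k) :: 'n mpoly"
  have split: "diff_op m H ?X = (\<Sum>j<k. mderiv j ?X ** H j) + mat [:fact k:] ** H k" for H
  proof -
    have "diff_op m H ?X = (\<Sum>j\<in>{..k}. mderiv j ?X ** H j)"
      unfolding diff_op_def using less.prems
      by (intro sum.mono_neutral_right) (auto simp: mderiv_mat_monom)
    also have "\<dots> = (\<Sum>j<k. mderiv j ?X ** H j) + mderiv k ?X ** H k"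
      by (simp add: lessThan_Suc_atMost[symmetric])
    finally show ?thesis
      by (simp add: mderiv_mat_monom)
  qed
  have "(\<Sum>j<k. mderiv j ?X ** F j) = (\<Sum>j<k. mderiv j ?X ** G j)"
    using less by (intro sum.cong) auto
  then have "mat [:fact k:] ** F k = mat [:fact k:] ** G k"
    using split[of F] split[of G] eq by simp
  then show ?case
    by (simp add: vec_eq_iff matrix_matrix_mult_def mat_def if_distrib[where f = "\<lambda>x. x * _"]
        cong: if_cong) (meson fact_nonzero smult_cancel)
qed

text \<open>
  The degree of \<open>0\<close> is read as \<open>-\<infinity>\<close>, so a degree-preserving operator annihilates no nonzero
  polynomial.
\<close>

definition degree_preserving :: "'n::finite oper \<Rightarrow> bool"
  where "degree_preserving V \<longleftrightarrow> (\<forall>P. (V P = 0 \<longleftrightarrow> P = 0) \<and> mdegree (V P) = mdegree P)"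

definition bispectral_algebra ::
  "ereal \<Rightarrow> ereal \<Rightarrow> (real \<Rightarrow> 'n::finite cmat) \<Rightarrow> 'n oper set"  (\<open>\<D>\<close>)
  where "\<D> x0 x1 W = {D \<in> diff_ops.
    \<forall>n. \<exists>\<Lambda>. D (monic_ops x0 x1 W n) = mconst \<Lambda> ** monic_ops x0 x1 W n}"

definition bispectral_center ::
  "ereal \<Rightarrow> ereal \<Rightarrow> (real \<Rightarrow> 'n::finite cmat) \<Rightarrow> 'n oper set"  (\<open>\<Z>\<close>)
  where "\<Z> x0 x1 W = {Z \<in> \<D> x0 x1 W. \<forall>B\<in>\<D> x0 x1 W. Z \<odot> B = B \<odot> Z}"

end

theory Submission
  imports Defs
begin

text \<open>
  The operators \<open>V\<close> and \<open>N\<close> intertwine the two families of orthogonal polynomials. By hypothesis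
  \<open>V\<close> sends \<open>P n\<close> to \<open>A n\<close> times \<open>Pt n\<close>. Since \<open>V\<close> annihilates no nonzero polynomial, \<open>A n\<close> is
  invertible (\<open>darboux_coeff_invertible\<close>). As \<open>P n\<close> is an eigenfunction of \<open>D = V N\<close>, it follows
  that \<open>N\<close> sends \<open>Pt n\<close> back to a constant multiple of \<open>P n\<close>. Hence \<open>C \<mapsto> V C N\<close> maps the algebra
  of \<open>Wt\<close> into that of \<open>W\<close>, and \<open>B \<mapsto> N B V\<close> maps in the other direction
  (\<open>intertwined_bispectral\<close>).

  Centrality is then a computation followed by a cancellation. For \<open>B\<close> central in the algebra of
  \<open>W\<close> and \<open>C\<close> in the algebra of \<open>Wt\<close>,
  \<open>V (N B V C) N = D B (V C N) = (V C N) B D = V (C N B V) N\<close>,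
  because \<open>B\<close> and \<open>D\<close> commute with \<open>V C N\<close>. Here \<open>N\<close> acts last and can be cancelled because it is
  injective, and \<open>V\<close> acts first and can be cancelled because every \<open>Pt n\<close> lies in its range, and
  an operator is determined by its values on the \<open>Pt n\<close> (\<open>left_linear_eqI\<close>). Taking \<open>B = 1\<close> shows
  that \<open>N V\<close> is central. Conversely, for \<open>C\<close> central in the algebra of \<open>Wt\<close> and \<open>B\<close> in the algebra
  of \<open>W\<close>, both \<open>(V C N) B D\<close> and \<open>B (V C N) D\<close> equal \<open>B V (N V) C N\<close>, since \<open>C\<close> commutes with
  \<open>N B V\<close> and with \<open>N V\<close>, and \<open>D\<close> with \<open>B\<close>; this time \<open>D\<close> is cancelled.

  Two facts from the general theory support this. The product of two differential operators is
  a differential operator (\<open>diff_ops_mult\<close>), by the Leibniz rule. The algebra attached to a weight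
  is defined through a definite description of the monic orthogonal polynomials, so that the
  given families must be shown to be the only ones (\<open>monic_orthogonal_unique\<close>). This rests on the
  definiteness of the form (\<open>form_definite\<close>).
\<close>

section \<open>Matrix polynomials and their expansion along monic sequences\<close>

lemma matrix_add_rdistrib: "(A + B) ** C = A ** C + B ** (C :: 'a::semiring_1 ^ 'p ^ 'n::finite)"
  by (simp add: matrix_matrix_mult_def vec_eq_iff sum.distrib algebra_simps)

lemma matrix_diff_rdistrib: "(A - B) ** C = A ** C - B ** (C :: 'a::ring_1 ^ 'p ^ 'n::finite)"
  by (simp add: matrix_matrix_mult_def vec_eq_iff sum_subtractf algebra_simps)

lemma matrix_sum_mult: "(\<Sum>i\<in>I. f i) ** C = (\<Sum>i\<in>I. f i ** (C :: 'a::semiring_1 ^ 'p ^ 'n::finite))"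
  by (induction I rule: infinite_finite_induct) (simp_all add: matrix_add_rdistrib)

lemma matrix_mult_sum: "C ** (\<Sum>i\<in>I. f i) = (\<Sum>i\<in>I. C ** (f i :: 'a::semiring_1 ^ 'p ^ 'n::finite))"
  by (induction I rule: infinite_finite_induct) (simp_all add: matrix_add_ldistrib)

lemma mconst_mult: "mconst (A ** B) = mconst A ** mconst B"
proof -
  have "[:\<Sum>k\<in>K. f k:] = (\<Sum>k\<in>K. [:f k:])" for f :: "'a \<Rightarrow> complex" and K
    by (simp add: poly_eq_iff coeff_sum coeff_pCons split: nat.split)
  then show ?thesis
    by (simp add: mconst_def matrix_matrix_mult_def vec_eq_iff mult.commute)
qed

lemma mconst_one: "mconst (mat 1) = mat 1"
  by (simp add: mconst_def mat_def vec_eq_iff one_pCons)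

lemma mconst_zero: "mconst 0 = 0"
  by (simp add: mconst_def vec_eq_iff)

lemma mconst_mult_entry: "(mconst C ** P) $ i $ j = (\<Sum>l\<in>UNIV. smult (C $ i $ l) (P $ l $ j))"
  by (simp add: mconst_def matrix_matrix_mult_def)

lemma mcoeff_mconst_mult: "mcoeff (mconst C ** P) k = C ** mcoeff P k"
  by (simp add: mcoeff_def vec_eq_iff mconst_mult_entry coeff_sum)
    (simp add: matrix_matrix_mult_def)

lemma mcoeff_diff: "mcoeff (P - Q) k = mcoeff P k - mcoeff Q k"
  by (simp add: mcoeff_def vec_eq_iff)

lemma mcoeff_zero: "mcoeff 0 k = 0"
  by (simp add: mcoeff_def vec_eq_iff)

lemma mpoly_eq_0_iff_mcoeff: "P = 0 \<longleftrightarrow> (\<forall>k. mcoeff P k = 0)"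
  by (auto simp: mcoeff_def vec_eq_iff poly_eq_iff)

lemma degree_le_mdegree: "degree (P $ i $ j) \<le> mdegree P"
  unfolding mdegree_def by (rule Max_ge) (auto intro!: range_eqI[of _ _ "(i, j)"])

lemma mcoeff_above_mdegree: "mdegree P < k \<Longrightarrow> mcoeff P k = 0"
  by (simp add: mcoeff_def vec_eq_iff) (meson coeff_eq_0 degree_le_mdegree le_less_trans)

text \<open>
  The degree is expressed by vanishing coefficients: unlike \<^const>\<open>mdegree\<close>, these are additive, so
  that the difference of two monic polynomials needs no discussion of its degree.
\<close>

definition monic_sequence :: "(nat \<Rightarrow> 'n::finite mpoly) \<Rightarrow> bool"
  where "monic_sequence P \<longleftrightarrow> (\<forall>n. mcoeff (P n) n = mat 1 \<and> (\<forall>k>n. mcoeff (P n) k = 0))"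

lemma monic_sequence_orthogonal: "monic_orthogonal x0 x1 W P \<Longrightarrow> monic_sequence P"
  by (auto simp: monic_orthogonal_def monic_sequence_def intro: mcoeff_above_mdegree)

text \<open>
  A matrix polynomial of degree below \<open>n\<close> is a combination of the first \<open>n\<close> members of a monic
  sequence with constant matrices as left coefficients: subtracting the leading coefficient times
  the member of the same degree lowers the degree. The expansion is given as an induction rule,
  which is how it is used.
\<close>

lemma monic_sequence_induct [consumes 1, case_names low zero add]:
  assumes "monic_sequence P" and "\<And>k. n \<le> k \<Longrightarrow> mcoeff Q k = 0"
    and zero: "S 0" and add: "\<And>C k R. k < n \<Longrightarrow> S R \<Longrightarrow> S (R + mconst C ** P k)"
  shows "S Q"
  using assms(2) add
proof (induction n arbitrary: Q)
  case 0
  then show ?case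
    using zero mpoly_eq_0_iff_mcoeff[of Q] by simp
next
  case (Suc n)
  define R where "R = Q - mconst (mcoeff Q n) ** P n"
  have "mcoeff R k = 0" if "n \<le> k" for k
    using that Suc.prems(1)[of k] \<open>monic_sequence P\<close>
    by (cases "k = n") (auto simp: R_def mcoeff_diff mcoeff_mconst_mult monic_sequence_def)
  then have "S R"
    using Suc.IH[of R] Suc.prems(2) by simp
  then show ?case
    using Suc.prems(2)[of n R "mcoeff Q n"] by (simp add: R_def)
qed

lemma mconst_mult_monic_eq_0:
  assumes "monic_sequence P" and "mconst C ** P n = 0"
  shows "C = 0"
  using mcoeff_mconst_mult[of C "P n" n] assms by (simp add: monic_sequence_def mcoeff_zero)

text \<open>
  A row vector annihilated by \<open>A\<close> yields a matrix annihilated by \<open>A\<close>, all of whose rows are equal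
  to that vector.
\<close>

lemma invertible_if_left_kernel_trivial:
  fixes A :: "'a::field ^ 'n ^ 'n"
  assumes "\<And>C :: 'a ^ 'n ^ 'n. C ** A = 0 \<Longrightarrow> C = 0"
  shows "invertible A"
proof -
  have "x = 0" if "transpose A *v x = 0" for x
  proof -
    have "(\<chi> i. x) ** A = (0 :: 'a ^ 'n ^ 'n)"
      using that by (simp add: matrix_matrix_mult_def matrix_vector_mult_def transpose_def vec_eq_iff mult.commute)
    then have "(\<chi> i. x) = (0 :: 'a ^ 'n ^ 'n)"
      by (rule assms)
    then show ?thesis
      by (simp add: vec_eq_iff)
  qed
  then have "\<exists>B. B ** transpose A = mat 1"
    using matrix_left_invertible_ker by blast
  then show ?thesis
    by (simp add: left_invertible_transpose invertible_right_inverse)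
qed


section \<open>The algebra of differential operators\<close>

text \<open>
  Operators act on the right, so they commute with multiplication by constant matrices from the
  left, but in general not from the right.
\<close>

definition left_linear :: "'n::finite oper \<Rightarrow> bool"
  where "left_linear D \<longleftrightarrow> (\<forall>P Q. D (P + Q) = D P + D Q) \<and> (\<forall>C P. D (mconst C ** P) = mconst C ** D P)"

lemma left_linear_zero: "left_linear D \<Longrightarrow> D 0 = 0"
  unfolding left_linear_def by (metis mconst_zero times0_left)

lemma left_linear_diff:
  assumes "left_linear D"
  shows "D (P - Q) = D P - D Q"
proof -
  have "D (P - Q) + D Q = D P"
    using assms unfolding left_linear_def by (metis diff_add_cancel)
  then show ?thesis
    by (simp add: algebra_simps)
qed

lemma mderiv_0: "mderiv 0 P = P"
  by (simp add: mderiv_def vec_eq_iff)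

lemma mderiv_Suc: "mderiv (Suc k) P = mderiv (Suc 0) (mderiv k P)"
  by (simp add: mderiv_def vec_eq_iff)

lemma mderiv_1_mult: "mderiv (Suc 0) (P ** Q) = mderiv (Suc 0) P ** Q + P ** mderiv (Suc 0) Q"
proof -
  have "pderiv (\<Sum>l\<in>K. f l) = (\<Sum>l\<in>K. pderiv (f l))" for f :: "'a \<Rightarrow> complex poly" and K
    by (induction K rule: infinite_finite_induct) (simp_all add: pderiv_add)
  then show ?thesis
    by (simp add: mderiv_def matrix_matrix_mult_def vec_eq_iff pderiv_mult sum.distrib algebra_simps)
qed

lemma mderiv_1_add: "mderiv (Suc 0) (P + Q) = mderiv (Suc 0) P + mderiv (Suc 0) Q"
  by (simp add: mderiv_def vec_eq_iff pderiv_add)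

lemma left_linear_mderiv: "left_linear (mderiv k)"
proof (induction k)
  case 0
  then show ?case
    by (simp add: left_linear_def mderiv_0)
next
  case (Suc k)
  have "mderiv (Suc 0) (mconst C) = 0" for C :: "complex ^ 'a ^ 'a"
    by (simp add: mderiv_def mconst_def vec_eq_iff pderiv_pCons)
  then show ?case
    using Suc unfolding left_linear_def mderiv_Suc[of k]
    by (simp add: mderiv_1_add mderiv_1_mult)
qed

lemma left_linear_diff_ops:
  assumes "D \<in> diff_ops"
  shows "left_linear D"
proof -
  obtain m F where D: "D = diff_op m F"
    using assms by (auto simp: diff_ops_def)
  show ?thesis
    by (simp add: D left_linear_mderiv[unfolded left_linear_def] left_linear_def diff_op_def matrix_add_rdistrib sum.distrib
        matrix_mult_sum matrix_mul_assoc)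
qed

text \<open>
  The members of a monic sequence generate all matrix polynomials over the constant matrices
  acting on the left.
\<close>

lemma left_linear_eqI:
  assumes D: "left_linear D" and E: "left_linear E" and P: "monic_sequence P"
    and eq: "\<And>n. D (P n) = E (P n)"
  shows "D = E"
proof
  fix Q
  from P have "D Q = E Q"
  proof (induction Q rule: monic_sequence_induct[where n = "Suc (mdegree Q)"])
    case (low k)
    then show ?case by (simp add: mcoeff_above_mdegree)
  next
    case zero
    then show ?case using D E by (simp add: left_linear_zero)
  next
    case (add C k R)
    then show ?case using D E eq by (simp add: left_linear_def)
  qed
  then show "D Q = E Q" .
qed

text \<open>To add operators, their orders are first made equal by zero coefficients.\<close>

lemma diff_op_pad:
  assumes "m \<le> M"
  shows "diff_op m F = diff_op M (\<lambda>j. if j \<le> m then F j else 0)"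
proof
  fix P
  have "(\<Sum>j\<le>M. mderiv j P ** (if j \<le> m then F j else 0)) = (\<Sum>j\<le>m. mderiv j P ** (if j \<le> m then F j else 0))"
    using assms by (intro sum.mono_neutral_right) auto
  then show "diff_op m F P = diff_op M (\<lambda>j. if j \<le> m then F j else 0) P"
    by (simp add: diff_op_def)
qed

lemma diff_ops_add:
  assumes "D \<in> diff_ops" and "E \<in> diff_ops"
  shows "(\<lambda>P. D P + E P) \<in> diff_ops"
proof -
  obtain m F m' G where D: "D = diff_op m F" and E: "E = diff_op m' G"
    using assms by (auto simp: diff_ops_def)
  define M where "M = max m m'"
  obtain F' G' where D': "D = diff_op M F'" and E': "E = diff_op M G'"
    unfolding D E using diff_op_pad[of m M F] diff_op_pad[of m' M G] by (auto simp: M_def)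
  have "(\<lambda>P. D P + E P) = diff_op M (\<lambda>j. F' j + G' j)"
    by (simp add: D' E' diff_op_def fun_eq_iff matrix_add_ldistrib sum.distrib)
  then show ?thesis
    by (auto simp: diff_ops_def)
qed

lemma diff_ops_zero: "(\<lambda>P. 0) \<in> diff_ops"
proof -
  have "(\<lambda>P. 0) = diff_op 0 (\<lambda>_. 0)"
    by (simp add: diff_op_def fun_eq_iff)
  then show ?thesis
    unfolding diff_ops_def by blast
qed

lemma diff_ops_id: "(\<lambda>P. P) \<in> diff_ops"
proof -
  have "(\<lambda>P. P) = diff_op 0 (\<lambda>_. mat 1)"
    by (simp add: diff_op_def fun_eq_iff mderiv_0)
  then show ?thesis
    unfolding diff_ops_def by blast
qed

lemma diff_ops_sum:
  assumes "\<And>j. j \<in> I \<Longrightarrow> D j \<in> diff_ops"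
  shows "(\<lambda>P. \<Sum>j\<in>I. D j P) \<in> diff_ops"
  using assms
  by (induction I rule: infinite_finite_induct) (simp_all add: diff_ops_zero diff_ops_add)

lemma diff_ops_times:
  assumes "D \<in> diff_ops"
  shows "(\<lambda>P. D P ** G) \<in> diff_ops"
proof -
  obtain m F where D: "D = diff_op m F"
    using assms by (auto simp: diff_ops_def)
  have "(\<lambda>P. D P ** G) = diff_op m (\<lambda>j. F j ** G)"
    by (simp add: D diff_op_def fun_eq_iff matrix_sum_mult matrix_mul_assoc)
  then show ?thesis
    by (auto simp: diff_ops_def)
qed

lemma diff_ops_mderiv: "(mderiv k :: 'n::finite oper) \<in> diff_ops"
proof -
  have "(\<Sum>j\<le>k. mderiv j P ** (if j = k then mat 1 else 0)) = (\<Sum>j\<in>{k}. mderiv j P ** (if j = k then mat 1 else 0))"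
    for P :: "'n mpoly"
    by (intro sum.mono_neutral_right) auto
  then have "mderiv k = diff_op k (\<lambda>j. if j = k then mat 1 else (0 :: 'n mpoly))"
    by (simp add: diff_op_def fun_eq_iff)
  then show ?thesis
    by (auto simp: diff_ops_def)
qed

text \<open>
  Differentiating \<open>k\<close> times after \<open>D\<close> is done one derivative at a time, so that only the Leibniz
  rule for the first derivative is used and no binomial coefficients appear.
\<close>

lemma mderiv_diff_ops:
  assumes "D \<in> diff_ops"
  shows "(\<lambda>P. mderiv k (D P)) \<in> diff_ops"
proof (induction k)
  case 0
  then show ?case using assms by (simp add: mderiv_0)
next
  case (Suc k)
  obtain m F where F: "(\<lambda>P. mderiv k (D P)) = diff_op m F"
    using Suc by (auto simp: diff_ops_def)
  have sum: "mderiv (Suc 0) (\<Sum>j\<in>I. g j) = (\<Sum>j\<in>I. mderiv (Suc 0) (g j))" for I and g :: "nat \<Rightarrow> 'a mpoly"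
    using left_linear_zero[OF left_linear_mderiv[of "Suc 0"]]
    by (induction I rule: infinite_finite_induct) (simp_all add: mderiv_1_add)
  have step: "mderiv (Suc 0) (mderiv j P ** G) = mderiv (Suc j) P ** G + mderiv j P ** mderiv (Suc 0) G"
    for j and P G :: "'a mpoly"
    by (simp add: mderiv_1_mult flip: mderiv_Suc)
  have "(\<lambda>P. mderiv (Suc k) (D P)) = (\<lambda>P. mderiv (Suc 0) (diff_op m F P))"
    using F by (simp add: mderiv_Suc[of k] fun_eq_iff)
  also have "\<dots> = (\<lambda>P. \<Sum>j\<le>m. mderiv (Suc j) P ** F j + mderiv j P ** mderiv (Suc 0) (F j))"
    by (simp only: diff_op_def sum step)
  also have "\<dots> \<in> diff_ops"
    by (intro diff_ops_sum diff_ops_add diff_ops_times diff_ops_mderiv)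
  finally show ?case .
qed

lemma diff_ops_mult:
  assumes "D \<in> diff_ops" and "E \<in> diff_ops"
  shows "D \<odot> E \<in> diff_ops"
proof -
  obtain m G where E: "E = diff_op m G"
    using assms by (auto simp: diff_ops_def)
  show ?thesis
    unfolding oper_mult_def E diff_op_def
    by (intro diff_ops_sum diff_ops_times mderiv_diff_ops assms)
qed


section \<open>Uniqueness of the monic orthogonal polynomials\<close>

lemma meval_sum: "meval P x = (\<Sum>k\<le>mdegree P. x ^ k *\<^sub>R mcoeff P k)"
proof -
  have "poly (P $ i $ j) (complex_of_real x) = (\<Sum>k\<le>mdegree P. coeff (P $ i $ j) k * complex_of_real x ^ k)"
    for i j
    unfolding poly_altdef using degree_le_mdegree[of P i j]
    by (intro sum.mono_neutral_left) (auto simp: coeff_eq_0)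
  then show ?thesis
    by (simp add: meval_def mcoeff_def vec_eq_iff scaleR_conv_of_real[where 'a = complex] mult.commute)
qed

lemma adjoint_meval_sum: "adjoint_mat (meval P x) = (\<Sum>k\<le>mdegree P. x ^ k *\<^sub>R adjoint_mat (mcoeff P k))"
  unfolding meval_sum by (simp add: adjoint_mat_def vec_eq_iff)

lemma scaleR_mult_mat: "r *\<^sub>R A ** B = r *\<^sub>R (A ** (B :: complex ^ 'p ^ 'n::finite))"
  by (simp add: matrix_matrix_mult_def vec_eq_iff scaleR_sum_right)

lemma mult_scaleR_mat: "A ** (r *\<^sub>R B) = r *\<^sub>R (A ** (B :: complex ^ 'p ^ 'n::finite))"
  by (simp add: matrix_matrix_mult_def vec_eq_iff scaleR_sum_right)

lemma bounded_linear_mult_left: "bounded_linear (\<lambda>M. A ** (M :: 'n::finite cmat))"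
  by (intro linear_conv_bounded_linear[THEN iffD1] linearI) (simp_all add: matrix_add_ldistrib mult_scaleR_mat)

lemma bounded_linear_mult_right: "bounded_linear (\<lambda>M. M ** (B :: 'n::finite cmat))"
  by (intro linear_conv_bounded_linear[THEN iffD1] linearI) (simp_all add: matrix_add_rdistrib scaleR_mult_mat)

lemma set_integrable_bounded_linear:
  assumes "bounded_linear T" and "set_integrable M S f"
  shows "set_integrable M S (\<lambda>x. T (f x))"
  using integrable_bounded_linear[OF assms(1), of M "\<lambda>x. indicator S x *\<^sub>R f x"] assms(2)
  by (simp add: set_integrable_def bounded_linear.linear[OF assms(1)] linear_cmul)

lemma set_integral_bounded_linear:
  fixes f :: "_ \<Rightarrow> _ :: {banach, second_countable_topology}"
    and T :: "_ \<Rightarrow> _ :: {banach, second_countable_topology}"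
  assumes "bounded_linear T" and "set_integrable M S f"
  shows "(LINT x:S|M. T (f x)) = T (LINT x:S|M. f x)"
  using integral_bounded_linear[OF assms(1), of M "\<lambda>x. indicator S x *\<^sub>R f x"] assms(2)
  by (simp add: set_integrable_def set_lebesgue_integral_def bounded_linear.linear[OF assms(1)] linear_cmul)

lemma set_integrable_sum:
  fixes f :: "'i \<Rightarrow> 'a \<Rightarrow> 'b :: {banach, second_countable_topology}"
  assumes "\<And>i. i \<in> I \<Longrightarrow> set_integrable M S (f i)"
  shows "set_integrable M S (\<lambda>x. \<Sum>i\<in>I. f i x)"
  using assms by (simp add: set_integrable_def scaleR_sum_right)

text \<open>
  The integrand is a finite linear combination of the functions \<open>x \<mapsto> A ** (x ^ m *\<^sub>R W x) ** B\<close>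
  with constant matrices \<open>A\<close> and \<open>B\<close>, to which the finiteness of the moments applies.
\<close>

lemma form_integrable:
  assumes "finite_moments x0 x1 W"
  shows "set_integrable lborel (einterval x0 x1) (\<lambda>x. meval P x ** W x ** adjoint_mat (meval Q x))"
proof -
  have "meval P x ** W x ** adjoint_mat (meval Q x) =
      (\<Sum>k\<le>mdegree P. \<Sum>l\<le>mdegree Q. mcoeff P k ** (x ^ (k + l) *\<^sub>R W x) ** adjoint_mat (mcoeff Q l))" for x
    unfolding meval_sum[of P] adjoint_meval_sum
    by (subst sum.swap) (simp add: matrix_sum_mult matrix_mult_sum scaleR_mult_mat mult_scaleR_mat
        scaleR_sum_right power_add mult.commute)
  moreover have "set_integrable lborel (einterval x0 x1)
      (\<lambda>x. \<Sum>k\<le>mdegree P. \<Sum>l\<le>mdegree Q. mcoeff P k ** (x ^ (k + l) *\<^sub>R W x) ** adjoint_mat (mcoeff Q l))"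
    using assms unfolding finite_moments_def
    by (intro set_integrable_sum set_integrable_bounded_linear[OF bounded_linear_mult_left]
        set_integrable_bounded_linear[OF bounded_linear_mult_right]) auto
  ultimately show ?thesis
    by simp
qed

lemma meval_add: "meval (P + Q) x = meval P x + meval Q x"
  by (simp add: meval_def vec_eq_iff)

lemma meval_diff: "meval (P - Q) x = meval P x - meval Q x"
  by (simp add: meval_def vec_eq_iff)

lemma meval_mconst_mult: "meval (mconst C ** P) x = C ** meval P x"
  by (simp add: meval_def vec_eq_iff mconst_mult_entry poly_sum) (simp add: matrix_matrix_mult_def)

lemma adjoint_mat_add: "adjoint_mat (A + B) = adjoint_mat A + adjoint_mat B"
  by (simp add: adjoint_mat_def vec_eq_iff)

lemma adjoint_mat_mult: "adjoint_mat (A ** B) = adjoint_mat B ** adjoint_mat A"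
  by (simp add: adjoint_mat_def matrix_matrix_mult_def vec_eq_iff mult.commute)

lemma form_zero_right: "form x0 x1 W (P :: 'a::finite mpoly) 0 = 0"
proof -
  have "adjoint_mat (meval (0 :: 'a mpoly) x) = 0" for x
    by (simp add: adjoint_mat_def meval_def vec_eq_iff)
  then show ?thesis
    by (simp add: form_def set_lebesgue_integral_def)
qed

lemma form_add_right:
  assumes "finite_moments x0 x1 W"
  shows "form x0 x1 W P (Q + R) = form x0 x1 W P Q + form x0 x1 W P R"
  unfolding form_def meval_add adjoint_mat_add matrix_add_ldistrib
  by (intro set_integral_add form_integrable assms)

lemma form_diff_left:
  assumes "finite_moments x0 x1 W"
  shows "form x0 x1 W (P - Q) R = form x0 x1 W P R - form x0 x1 W Q R"
  unfolding form_def meval_diff matrix_diff_rdistrib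
  by (intro set_integral_diff form_integrable assms)

lemma form_mconst_right:
  assumes "finite_moments x0 x1 W"
  shows "form x0 x1 W P (mconst C ** Q) = form x0 x1 W P Q ** adjoint_mat C"
  unfolding form_def meval_mconst_mult adjoint_mat_mult matrix_mul_assoc
  by (rule set_integral_bounded_linear[OF bounded_linear_mult_right form_integrable[OF assms]])

text \<open>
  The diagonal entry at \<open>i\<close> of the integrand is the value of the positive definite form given by
  \<open>W x\<close> at the conjugate of row \<open>i\<close> of \<open>Q\<close>. If its integral vanishes, this row vanishes at almost
  all points of the interval, whereas a nonzero polynomial has only finitely many roots.
\<close>

lemma form_definite:
  assumes W: "weight_matrix x0 x1 W" and zero: "form x0 x1 W Q Q = 0"
  shows "Q = 0"
proof -
  let ?S = "einterval x0 x1"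
  have "Q $ i $ j = 0" for i j
  proof (rule ccontr)
    assume nz: "Q $ i $ j \<noteq> 0"
    \<comment> \<open>The diagonal entry of the integrand, and the vector at which \<open>W x\<close> is evaluated in it.\<close>
    define g where "g x = Re ((meval Q x ** W x ** adjoint_mat (meval Q x)) $ i $ i)" for x
    define v where "v x = (\<chi> l. cnj (meval Q x $ i $ l))" for x
    have T: "bounded_linear (\<lambda>M :: 'a cmat. Re (M $ i $ i))"
      by (intro linear_conv_bounded_linear[THEN iffD1] linearI) simp_all
    have int: "set_integrable lborel ?S (\<lambda>x. meval Q x ** W x ** adjoint_mat (meval Q x))"
      using W by (intro form_integrable) (simp add: weight_matrix_def)
    have g_int: "set_integrable lborel ?S g"
      unfolding g_def by (rule set_integrable_bounded_linear[OF T int])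
    have "(LINT x:?S|lborel. g x) = Re (form x0 x1 W Q Q $ i $ i)"
      unfolding g_def form_def by (rule set_integral_bounded_linear[OF T int])
    then have g0: "(LINT x:?S|lborel. g x) = 0"
      by (simp add: zero)
    have g_eq: "g x = Re (\<Sum>k\<in>UNIV. \<Sum>l\<in>UNIV. cnj (v x $ k) * W x $ k $ l * v x $ l)" for x
    proof -
      have "(meval Q x ** W x ** adjoint_mat (meval Q x)) $ i $ i
        = (\<Sum>l\<in>UNIV. \<Sum>k\<in>UNIV. cnj (v x $ k) * W x $ k $ l * v x $ l)"
        by (simp add: matrix_matrix_mult_def adjoint_mat_def v_def sum_distrib_right)
      then show ?thesis
        unfolding g_def by (subst sum.swap) simp
    qed
    have pos: "AE x in lborel. x \<in> ?S \<longrightarrow> pos_def_mat (W x)"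
      using W by (simp add: weight_matrix_def)
    have "AE x in lborel. 0 \<le> indicator ?S x *\<^sub>R g x"
      using pos
    proof eventually_elim
      case (elim x)
      then show ?case
        by (cases "v x = 0") (auto simp: g_eq pos_def_mat_def indicator_def less_imp_le)
    qed
    then have "AE x in lborel. indicator ?S x *\<^sub>R g x = 0"
      using g0 g_int integral_nonneg_eq_0_iff_AE[of lborel "\<lambda>x. indicator ?S x *\<^sub>R g x"]
      by (simp add: set_integrable_def set_lebesgue_integral_def)
    then have "AE x in lborel. x \<in> ?S \<longrightarrow> poly (Q $ i $ j) (complex_of_real x) = 0"
      using pos
    proof eventually_elim
      case (elim x)
      show ?case
      proof
        assume "x \<in> ?S"
        then have "v x = 0"
          using elim by (cases "v x = 0") (auto simp: g_eq pos_def_mat_def)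
        then show "poly (Q $ i $ j) (complex_of_real x) = 0"
          by (simp add: v_def vec_eq_iff meval_def)
      qed
    qed
    moreover have "AE x in lborel. poly (Q $ i $ j) (complex_of_real x) \<noteq> 0"
    proof -
      have "finite {x. poly (Q $ i $ j) (complex_of_real x) = 0}"
        using finite_vimageI[OF poly_roots_finite[OF nz], of complex_of_real]
        by (simp add: vimage_def inj_def)
      from finite_imp_null_set_lborel[OF this] show ?thesis
        by (auto dest: AE_not_in)
    qed
    ultimately have "AE x in lborel. x \<notin> ?S"
      by eventually_elim auto
    then have "?S \<in> null_sets lborel"
      by (simp add: AE_iff_null_sets)
    then have "negligible ?S"
      using negligible_iff_null_sets null_sets_completionI by blast
    moreover have "?S \<noteq> {}"
      using W einterval_nonempty[of x0 x1] by (auto simp: weight_matrix_def)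
    moreover have "open ?S"
      by simp
    ultimately show False
      using open_not_negligible by blast
  qed
  then show ?thesis
    by (simp add: vec_eq_iff)
qed

text \<open>\<open>P n\<close> is orthogonal to each member of degree less than \<open>n\<close>, and these span all of lower degree.\<close>

lemma orthogonal_to_lower:
  assumes fm: "finite_moments x0 x1 W" and P: "monic_orthogonal x0 x1 W P"
    and "\<And>k. n \<le> k \<Longrightarrow> mcoeff R k = 0"
  shows "form x0 x1 W (P n) R = 0"
  using monic_sequence_orthogonal[OF P]
proof (induction R rule: monic_sequence_induct[where n = n])
  case (low k)
  then show ?case by (rule assms(3))
next
  case zero
  then show ?case by (simp add: form_zero_right)
next
  case (add C k R)
  then show ?case
    using P by (simp add: form_add_right[OF fm] form_mconst_right[OF fm] monic_orthogonal_def)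
qed

text \<open>
  The difference of the two monic polynomials of degree \<open>n\<close> has lower degree; it is therefore
  orthogonal to both of them, hence to itself.
\<close>

lemma monic_orthogonal_unique:
  assumes W: "weight_matrix x0 x1 W"
    and P: "monic_orthogonal x0 x1 W P" and Q: "monic_orthogonal x0 x1 W Q"
  shows "P = Q"
proof
  fix n
  have fm: "finite_moments x0 x1 W"
    using W by (simp add: weight_matrix_def)
  have low: "mcoeff (P n - Q n) k = 0" if "n \<le> k" for k
    using that monic_sequence_orthogonal[OF P] monic_sequence_orthogonal[OF Q]
    by (cases "k = n") (auto simp: mcoeff_diff monic_sequence_def)
  have "form x0 x1 W (P n - Q n) (P n - Q n) = 0"
    using orthogonal_to_lower[OF fm P low] orthogonal_to_lower[OF fm Q low]
    by (simp add: form_diff_left[OF fm])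
  then show "P n = Q n"
    using form_definite[OF W, of "P n - Q n"] by simp
qed

lemma bispectral_algebra_iff:
  assumes "weight_matrix x0 x1 W" and "monic_orthogonal x0 x1 W P"
  shows "D \<in> \<D> x0 x1 W \<longleftrightarrow> D \<in> diff_ops \<and> (\<forall>n. \<exists>L. D (P n) = mconst L ** P n)"
proof -
  have "monic_ops x0 x1 W = P"
    unfolding monic_ops_def using assms monic_orthogonal_unique by (intro the_equality) auto
  then show ?thesis
    by (simp add: bispectral_algebra_def)
qed


section \<open>Darboux transformations and centers\<close>

lemma oper_mult_assoc: "D \<odot> E \<odot> F = D \<odot> (E \<odot> F)"
  by (simp add: oper_mult_def)

text \<open>
  The hypotheses are symmetric in the two weights, so that this also gives the passage from \<open>W\<close> to
  \<open>Wt\<close>, with \<open>V\<close> and \<open>N\<close> exchanged.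
\<close>

lemma intertwined_bispectral:
  assumes "weight_matrix x0 x1 W" and P: "monic_orthogonal x0 x1 W P"
    and "weight_matrix x0 x1 Wt" and Pt: "monic_orthogonal x0 x1 Wt Pt"
    and V: "V \<in> diff_ops" and N: "N \<in> diff_ops"
    and VP: "\<And>n. V (P n) = mconst (A n) ** Pt n" and NP: "\<And>n. N (Pt n) = mconst (B n) ** P n"
    and C: "C \<in> \<D> x0 x1 Wt"
  shows "V \<odot> C \<odot> N \<in> \<D> x0 x1 W"
proof -
  have C': "C \<in> diff_ops" "\<And>n. \<exists>L. C (Pt n) = mconst L ** Pt n"
    using C assms bispectral_algebra_iff by blast+
  have "\<exists>L. (V \<odot> C \<odot> N) (P n) = mconst L ** P n" for n
  proof -
    obtain L where L: "C (Pt n) = mconst L ** Pt n"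
      using C' by blast
    have "(V \<odot> C \<odot> N) (P n) = mconst (A n ** L ** B n) ** P n"
      using left_linear_diff_ops[OF C'(1)] left_linear_diff_ops[OF N]
      by (simp add: oper_mult_def VP L NP left_linear_def mconst_mult matrix_mul_assoc[symmetric])
    then show ?thesis ..
  qed
  then show ?thesis
    using assms C' by (simp add: bispectral_algebra_iff[OF assms(1) P] diff_ops_mult)
qed

lemma degree_preserving_inj:
  assumes "left_linear V" and "degree_preserving V" and "V P = V Q"
  shows "P = Q"
  using left_linear_diff[OF assms(1), of P Q] assms(2,3) by (simp add: degree_preserving_def)

text \<open>
  If \<open>C ** A = 0\<close> then \<open>V\<close> annihilates the polynomial with leading coefficient \<open>C\<close> obtained from
  \<open>P n\<close>, so that \<open>C = 0\<close>.
\<close>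

lemma darboux_coeff_invertible:
  fixes A :: "'n::finite cmat"
  assumes P: "monic_sequence P" and V: "left_linear V" "degree_preserving V"
    and VP: "V (P n) = mconst A ** Q"
  shows "invertible A"
proof (rule invertible_if_left_kernel_trivial)
  fix C :: "'n cmat" assume "C ** A = 0"
  have "V (mconst C ** P n) = mconst (C ** A) ** Q"
    using V(1) unfolding left_linear_def by (simp add: VP mconst_mult matrix_mul_assoc)
  then have "V (mconst C ** P n) = 0"
    by (simp add: \<open>C ** A = 0\<close> mconst_zero)
  then have "mconst C ** P n = 0"
    using V(2) by (simp add: degree_preserving_def)
  with P show "C = 0"
    by (rule mconst_mult_monic_eq_0)
qed

theorem proposition4p1:
  fixes x0 x1 :: ereal
    and W Wt :: "real \<Rightarrow> 'n::finite cmat"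
    and P Pt :: "nat \<Rightarrow> 'n mpoly"
    and V N D :: "'n oper"
    and A :: "nat \<Rightarrow> 'n cmat"
  assumes "weight_matrix x0 x1 W" and "regular_weight x0 x1 W"
    and "weight_matrix x0 x1 Wt" and "regular_weight x0 x1 Wt"
    and "monic_orthogonal x0 x1 W P" and "monic_orthogonal x0 x1 Wt Pt"
    and "V \<in> diff_ops" and "N \<in> diff_ops"
    and "degree_preserving V" and "degree_preserving N"
    and "D = V \<odot> N" and "D \<in> \<D> x0 x1 W"
    and "\<And>n. V (P n) = mconst (A n) ** Pt n"
    and "D \<in> \<Z> x0 x1 W"
  shows "{N \<odot> B \<odot> V | B. B \<in> \<Z> x0 x1 W} \<subseteq> \<Z> x0 x1 Wt
    \<and> {V \<odot> C \<odot> N | C. C \<in> \<Z> x0 x1 Wt} \<subseteq> \<Z> x0 x1 W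
    \<and> N \<odot> V \<in> \<Z> x0 x1 Wt"
proof -
  note W = assms(1,5) and Wt = assms(3,6) and V = assms(7) and N = assms(8) and VP = assms(13)
  note D = assms(11)
  note P = monic_sequence_orthogonal[OF assms(5)] and Pt = monic_sequence_orthogonal[OF assms(6)]
  note linV = left_linear_diff_ops[OF V] and linN = left_linear_diff_ops[OF N]
  have linD: "left_linear D"
    unfolding D by (intro left_linear_diff_ops diff_ops_mult V N)
  have diff: "X \<in> diff_ops" if "X \<in> \<D> x0 x1 W \<or> X \<in> \<D> x0 x1 Wt" for X
    using that by (auto simp: bispectral_algebra_def)
  have "\<exists>A'. A' ** A n = mat 1" for n
  proof -
    have "invertible (A n)"
      using VP[of n] by (rule darboux_coeff_invertible[OF P linV assms(9)])
    then show ?thesis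
      by (simp add: invertible_left_inverse)
  qed
  then obtain A' where A': "\<And>n. A' n ** A n = mat 1"
    by metis
  have V_onto: "V (mconst (A' n) ** P n) = Pt n" for n
  proof -
    have "V (mconst (A' n) ** P n) = mconst (A' n ** A n) ** Pt n"
      using linV by (simp add: left_linear_def VP mconst_mult matrix_mul_assoc[symmetric])
    then show ?thesis
      by (simp add: A' mconst_one)
  qed
  have "\<forall>n. \<exists>L. D (P n) = mconst L ** P n"
    using assms(12) by (simp add: bispectral_algebra_iff[OF W])
  from choice[OF this] obtain L where L: "\<And>n. D (P n) = mconst (L n) ** P n"
    by blast
  have NP: "N (Pt n) = mconst (A' n ** L n) ** P n" for n
  proof -
    have "N (Pt n) = D (mconst (A' n) ** P n)"
      by (simp add: D oper_mult_def V_onto)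
    also have "\<dots> = mconst (A' n) ** D (P n)"
      using linD by (simp add: left_linear_def)
    also have "\<dots> = mconst (A' n ** L n) ** P n"
      by (simp add: L mconst_mult matrix_mul_assoc)
    finally show ?thesis .
  qed
  have VCN: "V \<odot> C \<odot> N \<in> \<D> x0 x1 W" if "C \<in> \<D> x0 x1 Wt" for C
    by (rule intertwined_bispectral[where A = A and B = "\<lambda>n. A' n ** L n", OF W Wt V N])
      (simp_all add: VP NP that)
  have NBV: "N \<odot> B \<odot> V \<in> \<D> x0 x1 Wt" if "B \<in> \<D> x0 x1 W" for B
    by (rule intertwined_bispectral[where A = "\<lambda>n. A' n ** L n" and B = A, OF Wt W N V])
      (simp_all add: VP NP that)
  have DB: "D \<odot> B = B \<odot> D" if "B \<in> \<D> x0 x1 W" for B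
    using assms(14) that by (simp add: bispectral_center_def)
  have sub: "N \<odot> B \<odot> V \<in> \<Z> x0 x1 Wt" if B: "B \<in> \<Z> x0 x1 W" for B
  proof -
    have B': "B \<in> \<D> x0 x1 W" "\<And>C. C \<in> \<D> x0 x1 W \<Longrightarrow> B \<odot> C = C \<odot> B"
      using B by (auto simp: bispectral_center_def)
    have "(N \<odot> B \<odot> V) \<odot> C = C \<odot> (N \<odot> B \<odot> V)" if C: "C \<in> \<D> x0 x1 Wt" for C
    proof (rule left_linear_eqI[OF _ _ Pt])
      show "left_linear (N \<odot> B \<odot> V \<odot> C)" "left_linear (C \<odot> (N \<odot> B \<odot> V))"
        using diff B'(1) C V N by (auto intro!: left_linear_diff_ops diff_ops_mult)
      fix n
      have "V \<odot> (N \<odot> B \<odot> V \<odot> C) \<odot> N = D \<odot> (B \<odot> (V \<odot> C \<odot> N))"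
        by (simp add: D oper_mult_assoc)
      also have "\<dots> = D \<odot> (V \<odot> C \<odot> N \<odot> B)"
        using B'(2)[OF VCN[OF C]] by simp
      also have "\<dots> = (V \<odot> C \<odot> N) \<odot> (D \<odot> B)"
        using DB[OF VCN[OF C]] by (metis oper_mult_assoc)
      also have "\<dots> = (V \<odot> C \<odot> N) \<odot> (B \<odot> D)"
        using DB[OF B'(1)] by simp
      also have "\<dots> = V \<odot> (C \<odot> (N \<odot> B \<odot> V)) \<odot> N"
        by (simp add: D oper_mult_assoc)
      finally have "N ((N \<odot> B \<odot> V \<odot> C) (V Q)) = N ((C \<odot> (N \<odot> B \<odot> V)) (V Q))" for Q
        by (metis oper_mult_def)
      then have "(N \<odot> B \<odot> V \<odot> C) (V Q) = (C \<odot> (N \<odot> B \<odot> V)) (V Q)" for Q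
        by (rule degree_preserving_inj[OF linN assms(10)])
      \<comment> \<open>\<open>N\<close> has been cancelled; \<open>V\<close> is cancelled by evaluating at a preimage of \<open>Pt n\<close>.\<close>
      from this[of "mconst (A' n) ** P n"]
      show "(N \<odot> B \<odot> V \<odot> C) (Pt n) = (C \<odot> (N \<odot> B \<odot> V)) (Pt n)"
        by (simp add: V_onto)
    qed
    then show ?thesis
      using NBV[OF B'(1)] by (simp add: bispectral_center_def)
  qed
  have "(\<lambda>Q. Q) \<in> \<D> x0 x1 W"
    unfolding bispectral_algebra_iff[OF W] using mconst_one by (metis diff_ops_id matrix_mul_lid)
  then have "(\<lambda>Q. Q) \<in> \<Z> x0 x1 W"
    by (simp add: bispectral_center_def oper_mult_def)
  from sub[OF this] have NV: "N \<odot> V \<in> \<Z> x0 x1 Wt"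
    by (simp add: oper_mult_def)
  have sup: "V \<odot> C \<odot> N \<in> \<Z> x0 x1 W" if C: "C \<in> \<Z> x0 x1 Wt" for C
  proof -
    have C': "C \<in> \<D> x0 x1 Wt" "\<And>B. B \<in> \<D> x0 x1 Wt \<Longrightarrow> C \<odot> B = B \<odot> C"
      using C by (auto simp: bispectral_center_def)
    have NV': "N \<odot> V \<in> \<D> x0 x1 Wt"
      using NV by (simp add: bispectral_center_def)
    have "(V \<odot> C \<odot> N) \<odot> B = B \<odot> (V \<odot> C \<odot> N)" if B: "B \<in> \<D> x0 x1 W" for B
    proof
      fix Q
      have "(V \<odot> C \<odot> N \<odot> B) \<odot> D = V \<odot> (C \<odot> (N \<odot> B \<odot> V)) \<odot> N"
        by (simp add: D oper_mult_assoc)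
      also have "\<dots> = V \<odot> ((N \<odot> B \<odot> V) \<odot> C) \<odot> N"
        using C'(2)[OF NBV[OF B]] by simp
      also have "\<dots> = (D \<odot> B) \<odot> (V \<odot> C \<odot> N)"
        by (simp add: D oper_mult_assoc)
      also have "\<dots> = B \<odot> V \<odot> ((N \<odot> V) \<odot> C) \<odot> N"
        unfolding DB[OF B] by (simp add: D oper_mult_assoc)
      also have "\<dots> = (B \<odot> (V \<odot> C \<odot> N)) \<odot> D"
        using C'(2)[OF NV'] by (metis D oper_mult_assoc)
      finally have "N (V ((V \<odot> C \<odot> N \<odot> B) Q)) = N (V ((B \<odot> (V \<odot> C \<odot> N)) Q))"
        by (metis D oper_mult_def)
      then have "V ((V \<odot> C \<odot> N \<odot> B) Q) = V ((B \<odot> (V \<odot> C \<odot> N)) Q)"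
        by (rule degree_preserving_inj[OF linN assms(10)])
      then show "(V \<odot> C \<odot> N \<odot> B) Q = (B \<odot> (V \<odot> C \<odot> N)) Q"
        by (rule degree_preserving_inj[OF linV assms(9)])
    qed
    then show ?thesis
      using VCN[OF C'(1)] by (simp add: bispectral_center_def)
  qed
  show ?thesis
    using sub sup NV by blast
qed

end
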